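(* For every $\varepsilon>0$ there exists $n_0\in\mathbb{N}$ such that for every integer $n\geq n_0$, every equi-$n$ square has a transversal of size at least $(3/4-\varepsilon)n$.
   Context: An equi-$n$ square is an $n\times n$ array filled with $n$ symbols, each symbol appearing exactly $n$ times. A transversal in an array filled with symbols is a collection of entries of the array no two of which share a row, a column, or a symbol; its size is the number of entries. *)

theory Defs
  imports Complex_Main
begin

text \<open>
  An \<open>n \<times> n\<close> array is a function \<open>A\<close> of a row and a column index; only its values at
  indices below \<open>n\<close> matter. The set \<open>S\<close> consists of the \<open>n\<close> available symbols.
\<close>

definition equi_square :: "nat \<Rightarrow> 'a set \<Rightarrow> (nat \<Rightarrow> nat \<Rightarrow> 'a) \<Rightarrow> bool" where
  "equi_square n S A \<longleftrightarrow>
     finite S \<and> card S = n \<and>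
     (\<forall>i<n. \<forall>j<n. A i j \<in> S) \<and>
     (\<forall>s\<in>S. card {(i, j). i < n \<and> j < n \<and> A i j = s} = n)"

definition is_transversal :: "nat \<Rightarrow> (nat \<Rightarrow> nat \<Rightarrow> 'a) \<Rightarrow> (nat \<times> nat) set \<Rightarrow> bool" where
  "is_transversal n A T \<longleftrightarrow>
     T \<subseteq> {..<n} \<times> {..<n} \<and>
     (\<forall>(i, j)\<in>T. \<forall>(k, l)\<in>T. (i, j) \<noteq> (k, l) \<longrightarrow> i \<noteq> k \<and> j \<noteq> l \<and> A i j \<noteq> A k l)"

end

theory Submission
  imports Defs
begin

text \<open>
  Extend a maximum transversal to a permutation \<open>\<sigma>\<close>; the \<open>u\<close> rows that carry no entry of the
  transversal are called holes. A row \<open>g\<close> is released if the transversal can be rearranged,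
  keeping its set of symbols, so that row \<open>g\<close> and column \<open>\<sigma> g\<close> become free. Holes are
  released. If \<open>r\<close> and \<open>r'\<close> are released by disjoint rearrangements, then the symbol in cell
  \<open>(r, \<sigma> r')\<close> must be used by the transversal, by maximality, and its entry can be moved to that
  cell, so that its own row becomes released too. Start with the set \<open>W\<close> of holes and enlarge it
  in this way in rounds. The cells in \<open>W \<times> \<sigma> W\<close> whose symbols are already those of rows in
  \<open>W\<close> number at most \<open>(|W| - u) n\<close>, and \<open>|W|\<^sup>2 - (|W| - u) n \<ge> u n - n\<^sup>2 / 4\<close>. So, if
  \<open>u \<ge> (1/4 + \<epsilon>) n\<close>, then each round adds linearly many rows to \<open>W\<close>, as long as every
  rearrangement touches, and every row is touched by, boundedly many others. After boundedly many
  rounds \<open>W\<close> would have more than \<open>n\<close> elements.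
\<close>

section \<open>Counting by fibres and extraction of conflict-free subsets\<close>

lemma card_le_fibres:
  assumes "finite B" and "\<And>b. b \<in> B \<Longrightarrow> card {x \<in> A. f x = b} \<le> k"
  shows "card {x \<in> A. f x \<in> B} \<le> card B * k"
proof -
  have eq: "{x \<in> A. f x \<in> B} = (\<Union>b\<in>B. {x \<in> A. f x = b})"
    by auto
  have "card {x \<in> A. f x \<in> B} \<le> (\<Sum>b\<in>B. card {x \<in> A. f x = b})"
    unfolding eq by (rule card_UN_le[OF assms(1)])
  also have "\<dots> \<le> (\<Sum>b\<in>B. k)"
    by (intro sum_mono assms(2))
  finally show ?thesis
    by simp
qed

text \<open>Take \<open>E\<close> of maximum size. An element of \<open>Q\<close> that agrees with
  no element of \<open>E\<close> under \<open>f\<close>, \<open>g\<close> or \<open>h\<close> could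
  be added, so \<open>Q\<close> is covered by \<open>3 * card E\<close> fibres, each of size at most
  \<open>k\<close>.\<close>

lemma exists_large_partial_transversal:
  assumes "finite Q"
    and f: "\<And>b. card {x \<in> Q. f x = b} \<le> k"
    and g: "\<And>b. card {x \<in> Q. g x = b} \<le> k"
    and h: "\<And>b. card {x \<in> Q. h x = b} \<le> k"
  obtains E where "E \<subseteq> Q" "inj_on f E" "inj_on g E" "inj_on h E" "card Q \<le> 3 * k * card E"
proof -
  define P where "P E \<longleftrightarrow> E \<subseteq> Q \<and> inj_on f E \<and> inj_on g E \<and> inj_on h E" for E
  have "P {}" unfolding P_def by simp
  moreover have "\<forall>E. P E \<longrightarrow> card E < Suc (card Q)"
    unfolding P_def using card_mono[OF \<open>finite Q\<close>] by (auto simp: less_Suc_eq_le)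
  ultimately obtain E where E: "P E" and max: "\<And>E'. P E' \<Longrightarrow> card E' \<le> card E"
    using ex_has_greatest_nat[of P "{}" card] by blast
  have fin: "finite E" using E \<open>finite Q\<close> finite_subset unfolding P_def by blast
  have "x \<in> {x \<in> Q. f x \<in> f ` E} \<union> {x \<in> Q. g x \<in> g ` E} \<union> {x \<in> Q. h x \<in> h ` E}" if "x \<in> Q" for x
  proof (rule ccontr)
    assume n: "\<not> ?thesis"
    then have "x \<notin> E" using that by auto
    moreover have "P (insert x E)"
      using E n that unfolding P_def by (auto simp: inj_on_insert)
    ultimately show False using max[of "insert x E"] fin by simp
  qed
  then have "card Q \<le> card ({x \<in> Q. f x \<in> f ` E} \<union> {x \<in> Q. g x \<in> g ` E} \<union> {x \<in> Q. h x \<in> h ` E})"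
    using \<open>finite Q\<close> by (intro card_mono) auto
  also have "\<dots> \<le> card {x \<in> Q. f x \<in> f ` E} + card {x \<in> Q. g x \<in> g ` E} + card {x \<in> Q. h x \<in> h ` E}"
    by (meson card_Un_le add_le_mono1 le_trans)
  also have "\<dots> \<le> card (f ` E) * k + card (g ` E) * k + card (h ` E) * k"
    using fin f g h by (intro add_mono card_le_fibres) auto
  also have "\<dots> = 3 * k * card E"
    using E unfolding P_def by (simp add: card_image)
  finally show ?thesis
    using that E unfolding P_def by blast
qed

section \<open>Rearrangements of a maximum transversal\<close>

lemma is_transversal_iff_inj:
  "is_transversal n A T \<longleftrightarrow>
     T \<subseteq> {..<n} \<times> {..<n} \<and> inj_on fst T \<and> inj_on snd T \<and> inj_on (\<lambda>p. A (fst p) (snd p)) T"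
  unfolding is_transversal_def inj_on_def case_prod_beta prod.collapse by blast

text \<open>The transversal is coded by its set of rows \<open>F\<close>, the entry in row
  \<open>r\<close> being \<open>(r, \<sigma> r)\<close>. Since \<sigma> permutes all indices, holes
  included, a row index \<open>r\<close> also names the column \<open>\<sigma> r\<close>, and one
  set of indices describes rows and columns at once.\<close>

locale maximum_transversal =
  fixes n :: nat and S :: "'a set" and A :: "nat \<Rightarrow> nat \<Rightarrow> 'a"
    and \<sigma> :: "nat \<Rightarrow> nat" and F :: "nat set"
  assumes equi: "equi_square n S A"
    and bij: "bij_betw \<sigma> {..<n} {..<n}"
    and F_sub: "F \<subseteq> {..<n}"
    and F_inj: "inj_on (\<lambda>r. A r (\<sigma> r)) F"
    and maximum: "\<And>T. is_transversal n A T \<Longrightarrow> card T \<le> card F"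
begin

abbreviation row_symbol :: "nat \<Rightarrow> 'a" where
  "row_symbol r \<equiv> A r (\<sigma> r)"

abbreviation cell_symbol :: "nat \<times> nat \<Rightarrow> 'a" where
  "cell_symbol p \<equiv> A (fst p) (snd p)"

lemma \<sigma>_inj: "inj_on \<sigma> {..<n}"
  using bij by (rule bij_betw_imp_inj_on)

lemma \<sigma>_less: "r < n \<Longrightarrow> \<sigma> r < n"
  using bij by (auto simp: bij_betw_def)

text \<open>
  \<open>R\<close> and \<open>C\<close> are both sets of row indices: \<open>C\<close> stands for the columns \<open>\<sigma> ` C\<close>.
\<close>

definition rearrangement :: "nat set \<Rightarrow> nat set \<Rightarrow> 'a set \<Rightarrow> (nat \<times> nat) set \<Rightarrow> bool" where
  "rearrangement R C X N \<longleftrightarrow>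
     inj_on fst N \<and> inj_on snd N \<and> inj_on cell_symbol N \<and>
     fst ` N \<subseteq> R \<and> snd ` N \<subseteq> \<sigma> ` C \<and> cell_symbol ` N = X"

lemma rearrangement_Un:
  assumes N: "rearrangement R C X N" and N': "rearrangement R' C' X' N'"
    and "R \<inter> R' = {}" "C \<inter> C' = {}" "X \<inter> X' = {}" "C \<subseteq> {..<n}" "C' \<subseteq> {..<n}"
  shows "rearrangement (R \<union> R') (C \<union> C') (X \<union> X') (N \<union> N')"
proof -
  \<comment> \<open>\<open>inj_on_Un\<close> asks only that the two set differences have disjoint
    images; disjoint ranges of rows or of columns give this.\<close>
  have disj: "f ` (N - N') \<inter> f ` (N' - N) = {}" if "f ` N \<subseteq> Y" "f ` N' \<subseteq> Y'" "Y \<inter> Y' = {}"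
    for f :: "nat \<times> nat \<Rightarrow> 'b" and Y Y'
    using that by blast
  have "\<sigma> ` C \<inter> \<sigma> ` C' = {}"
    using assms(4,6,7) \<sigma>_inj by (auto dest: inj_onD)
  then have "snd ` (N - N') \<inter> snd ` (N' - N) = {}"
    using N N' unfolding rearrangement_def by (intro disj[of _ "\<sigma> ` C" "\<sigma> ` C'"]) auto
  moreover have "fst ` (N - N') \<inter> fst ` (N' - N) = {}"
    using N N' assms(3) unfolding rearrangement_def by (intro disj[of _ R R']) auto
  moreover have "cell_symbol ` (N - N') \<inter> cell_symbol ` (N' - N) = {}"
    using N N' assms(5) unfolding rearrangement_def by blast
  ultimately show ?thesis
    using N N' unfolding rearrangement_def
    by (simp add: inj_on_Un image_Un) blast
qed

lemma rearrangement_mono: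
  "rearrangement R C X N \<Longrightarrow> R \<subseteq> R' \<Longrightarrow> C \<subseteq> C' \<Longrightarrow> rearrangement R' C' X N"
  unfolding rearrangement_def by blast

lemma rearrangement_singleton: "rearrangement {r} {c} {A r (\<sigma> c)} {(r, \<sigma> c)}"
  unfolding rearrangement_def by simp

section \<open>Released rows\<close>

text \<open>\<open>D\<close> confines the change: the symbols of the entries in rows
  \<open>D\<close> are placed again within the rows and columns of \<open>D - {g}\<close>. Entries
  outside \<open>D\<close> stay as they are, so rearrangements with disjoint \<open>D\<close> can be
  carried out together.\<close>

definition releasable :: "nat set \<Rightarrow> nat \<Rightarrow> bool" where
  "releasable D g \<longleftrightarrow> g \<in> D \<and> D \<subseteq> {..<n} \<and>
     (\<exists>N. rearrangement (D - {g}) (D - {g}) (row_symbol ` (D \<inter> F)) N)"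

text \<open>Done together, the two rearrangements leave row \<open>r\<close> and column
  \<open>\<sigma> r'\<close> empty, so the cell where these meet takes one more entry; the last
  hypothesis keeps its symbol apart from the others.\<close>

lemma rearrangement_fill:
  assumes "releasable D r" "releasable D' r'" "D \<inter> D' = {}"
    and "A r (\<sigma> r') \<notin> row_symbol ` ((D \<union> D') \<inter> F)"
  obtains N where "rearrangement (D \<union> D') (D \<union> D')
    (insert (A r (\<sigma> r')) (row_symbol ` ((D \<union> D') \<inter> F))) N"
proof -
  obtain N N' where N: "rearrangement (D - {r}) (D - {r}) (row_symbol ` (D \<inter> F)) N"
    and N': "rearrangement (D' - {r'}) (D' - {r'}) (row_symbol ` (D' \<inter> F)) N'"
    using assms(1,2) unfolding releasable_def by blast
  have sub: "r \<in> D" "r' \<in> D'" "D \<subseteq> {..<n}" "D' \<subseteq> {..<n}"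
    using assms(1,2) unfolding releasable_def by auto
  have "row_symbol ` (D \<inter> F) \<inter> row_symbol ` (D' \<inter> F) = {}"
    using F_inj assms(3) by (auto dest: inj_onD)
  then have "rearrangement ((D - {r}) \<union> (D' - {r'})) ((D - {r}) \<union> (D' - {r'}))
      (row_symbol ` (D \<inter> F) \<union> row_symbol ` (D' \<inter> F)) (N \<union> N')"
    using assms(3) sub by (intro rearrangement_Un[OF N N']) auto
  from rearrangement_Un[OF rearrangement_singleton[of r r'] this]
  have "rearrangement ({r} \<union> ((D - {r}) \<union> (D' - {r'}))) ({r'} \<union> ((D - {r}) \<union> (D' - {r'})))
      ({A r (\<sigma> r')} \<union> (row_symbol ` (D \<inter> F) \<union> row_symbol ` (D' \<inter> F))) ({(r, \<sigma> r')} \<union> (N \<union> N'))"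
    using assms(3,4) sub by (auto simp: image_Un Int_Un_distrib2)
  then have "rearrangement (D \<union> D') (D \<union> D')
      (insert (A r (\<sigma> r')) (row_symbol ` ((D \<union> D') \<inter> F))) ({(r, \<sigma> r')} \<union> (N \<union> N'))"
    using sub by (auto simp: image_Un Int_Un_distrib2 elim!: rearrangement_mono)
  then show ?thesis by (rule that)
qed

text \<open>The cell \<open>(r, \<sigma> r')\<close> takes over the symbol of row \<open>s\<close>.
  The old entry of \<open>s\<close> can then be dropped, which empties row \<open>s\<close> and
  column \<open>\<sigma> s\<close>.\<close>

lemma releasable_step:
  assumes "releasable D r" "releasable D' r'" "D \<inter> D' = {}"
    and s: "s \<in> F - (D \<union> D')" "A r (\<sigma> r') = row_symbol s"
  shows "releasable (insert s (D \<union> D')) s"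
proof -
  have "A r (\<sigma> r') \<notin> row_symbol ` ((D \<union> D') \<inter> F)"
    using s F_inj by (auto dest: inj_onD)
  from rearrangement_fill[OF assms(1-3) this] obtain N where
    N: "rearrangement (D \<union> D') (D \<union> D') (insert (row_symbol s) (row_symbol ` ((D \<union> D') \<inter> F))) N"
    unfolding s(2) .
  have "insert s (D \<union> D') - {s} = D \<union> D'"
    "row_symbol ` (insert s (D \<union> D') \<inter> F) = insert (row_symbol s) (row_symbol ` ((D \<union> D') \<inter> F))"
    using s by auto
  then show ?thesis
    using N assms(1,2) s(1) F_sub unfolding releasable_def by auto
qed

text \<open>Otherwise, filling the cell and keeping the entries of the rows in \<open>F\<close>
  outside \<open>D \<union> D'\<close> gives a transversal larger than the maximum.\<close>

lemma symbol_used: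
  assumes "releasable D r" "releasable D' r'" "D \<inter> D' = {}"
  shows "A r (\<sigma> r') \<in> row_symbol ` F"
proof (rule ccontr)
  assume unused: "A r (\<sigma> r') \<notin> row_symbol ` F"
  then have "A r (\<sigma> r') \<notin> row_symbol ` ((D \<union> D') \<inter> F)" by blast
  from rearrangement_fill[OF assms this] obtain N where
    N: "rearrangement (D \<union> D') (D \<union> D')
      (insert (A r (\<sigma> r')) (row_symbol ` ((D \<union> D') \<inter> F))) N" .
  define G where "G = F - (D \<union> D')"
  have D: "D \<union> D' \<subseteq> {..<n}" using assms unfolding releasable_def by blast
  have G: "G \<subseteq> {..<n}" "G \<subseteq> F" using F_sub unfolding G_def by auto
  have "rearrangement G G (row_symbol ` G) ((\<lambda>r. (r, \<sigma> r)) ` G)"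
    using inj_on_subset[OF \<sigma>_inj G(1)] inj_on_subset[OF F_inj G(2)]
    unfolding rearrangement_def by (auto simp: inj_on_def image_image)
  moreover have "insert (A r (\<sigma> r')) (row_symbol ` ((D \<union> D') \<inter> F)) \<inter> row_symbol ` G = {}"
    using unused F_inj unfolding G_def by (auto dest: inj_onD)
  ultimately have "rearrangement ((D \<union> D') \<union> G) ((D \<union> D') \<union> G)
      (insert (A r (\<sigma> r')) (row_symbol ` ((D \<union> D') \<inter> F)) \<union> row_symbol ` G)
      (N \<union> (\<lambda>r. (r, \<sigma> r)) ` G)"
    using G D by (intro rearrangement_Un[OF N]) (auto simp: G_def)
  moreover have "insert (A r (\<sigma> r')) (row_symbol ` ((D \<union> D') \<inter> F)) \<union> row_symbol ` G
      = insert (A r (\<sigma> r')) (row_symbol ` F)"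
    unfolding G_def by blast
  ultimately obtain T where
    T: "rearrangement ((D \<union> D') \<union> G) ((D \<union> D') \<union> G) (insert (A r (\<sigma> r')) (row_symbol ` F)) T"
    by metis
  have "T \<subseteq> fst ` T \<times> snd ` T" by force
  also have "\<dots> \<subseteq> {..<n} \<times> {..<n}"
  proof (rule Sigma_mono)
    show "fst ` T \<subseteq> {..<n}" using T D G unfolding rearrangement_def by blast
    have "snd ` T \<subseteq> \<sigma> ` {..<n}" using T D G unfolding rearrangement_def by blast
    then show "snd ` T \<subseteq> {..<n}" using \<sigma>_less by auto
  qed
  finally have "is_transversal n A T"
    using T unfolding is_transversal_iff_inj rearrangement_def by blast
  then have "card T \<le> card F" by (rule maximum)
  \<comment> \<open>The entries of \<open>T\<close> have distinct symbols, so \<open>T\<close> is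
    counted through its symbols.\<close>
  moreover have "card T = card (insert (A r (\<sigma> r')) (row_symbol ` F))"
    using T card_image unfolding rearrangement_def by metis
  moreover have "\<dots> = Suc (card F)"
    using unused finite_subset[OF F_sub] F_inj by (simp add: card_image)
  ultimately show False by simp
qed

section \<open>Families of released rows\<close>

text \<open>\<open>D g \<subseteq> W\<close> guarantees that a row outside \<open>W\<close> avoids
  every \<open>D g\<close>, as \<open>releasable_step\<close> requires. The two bounds by
  \<open>K\<close> together limit the number of overlapping pairs.\<close>

definition release_family :: "nat set \<Rightarrow> (nat \<Rightarrow> nat set) \<Rightarrow> nat \<Rightarrow> bool" where
  "release_family W D K \<longleftrightarrow>
     {..<n} - F \<subseteq> W \<and> W \<subseteq> {..<n} \<and>
     (\<forall>g\<in>W. releasable (D g) g \<and> D g \<subseteq> W \<and> card (D g) \<le> K) \<and>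
     (\<forall>x. card {g \<in> W. x \<in> D g} \<le> K)"

lemma release_family_holes: "release_family ({..<n} - F) (\<lambda>h. {h}) 1"
proof -
  have "releasable {h} h" if "h \<in> {..<n} - F" for h
    using that unfolding releasable_def rearrangement_def
    by (auto intro!: exI[of _ "{}"])
  moreover have "card {g \<in> {..<n} - F. x \<in> {g}} \<le> 1" for x
    by (rule card_le_Suc0_iff_eq[THEN iffD2, folded One_nat_def]) auto
  ultimately show ?thesis
    unfolding release_family_def by auto
qed

lemma card_symbol_pairs:
  assumes "W \<subseteq> {..<n}"
  shows "card {p \<in> W \<times> W. A (fst p) (\<sigma> (snd p)) = a} \<le> n"
proof -
  let ?P = "{p \<in> W \<times> W. A (fst p) (\<sigma> (snd p)) = a}"
  let ?C = "{(i, j). i < n \<and> j < n \<and> A i j = a}"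
  have fin: "finite ?C"
    by (rule finite_subset[of _ "{..<n} \<times> {..<n}"]) auto
  have "card ?C \<le> n"
  proof (cases "a \<in> S")
    case True
    then show ?thesis using equi unfolding equi_square_def by simp
  next
    case False
    then have "?C = {}" using equi unfolding equi_square_def by auto
    then show ?thesis by (metis card.empty zero_le)
  qed
  moreover have "inj_on (\<lambda>p. (fst p, \<sigma> (snd p))) ?P"
    using inj_on_subset[OF \<sigma>_inj assms] by (auto simp: inj_on_def)
  moreover have "(\<lambda>p. (fst p, \<sigma> (snd p))) ` ?P \<subseteq> ?C"
    using assms \<sigma>_less by auto
  ultimately show ?thesis
    using card_inj_on_le[OF _ _ fin] le_trans by blast
qed

text \<open>For fixed \<open>r\<close>, each of the at most \<open>K\<close> elements of
  \<open>D r\<close> lies in at most \<open>K\<close> sets \<open>D q\<close>, so \<open>r\<close>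
  conflicts with at most \<open>K\<^sup>2\<close> rows.\<close>

lemma card_conflicts:
  assumes "release_family W D K"
  shows "card {p \<in> W \<times> W. D (fst p) \<inter> D (snd p) \<noteq> {}} \<le> n * K\<^sup>2"
proof -
  have W: "finite W" "card W \<le> n"
    using assms unfolding release_family_def
    by (auto intro: finite_subset) (metis card_lessThan card_mono finite_lessThan)
  have row: "card {q \<in> W. D r \<inter> D q \<noteq> {}} \<le> K\<^sup>2" if "r \<in> W" for r
  proof -
    have "D r \<subseteq> W" "card (D r) \<le> K" using assms that unfolding release_family_def by auto
    then have fin: "finite (D r)" using W finite_subset by blast
    have eq: "{q \<in> W. D r \<inter> D q \<noteq> {}} = (\<Union>x\<in>D r. {q \<in> W. x \<in> D q})" by auto
    have "card {q \<in> W. D r \<inter> D q \<noteq> {}} \<le> (\<Sum>x\<in>D r. card {q \<in> W. x \<in> D q})"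
      unfolding eq by (rule card_UN_le[OF fin])
    also have "\<dots> \<le> (\<Sum>x\<in>D r. K)"
      using assms unfolding release_family_def by (intro sum_mono) auto
    also have "\<dots> \<le> K\<^sup>2"
      using \<open>card (D r) \<le> K\<close> by (simp add: power2_eq_square)
    finally show ?thesis .
  qed
  have "{p \<in> W \<times> W. D (fst p) \<inter> D (snd p) \<noteq> {}} = Sigma W (\<lambda>r. {q \<in> W. D r \<inter> D q \<noteq> {}})"
    by auto
  then have "card {p \<in> W \<times> W. D (fst p) \<inter> D (snd p) \<noteq> {}}
      = (\<Sum>r\<in>W. card {q \<in> W. D r \<inter> D q \<noteq> {}})"
    using W by simp
  also have "\<dots> \<le> (\<Sum>r\<in>W. K\<^sup>2)"
    by (intro sum_mono row)
  also have "\<dots> \<le> n * K\<^sup>2"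
    using W by simp
  finally show ?thesis .
qed

text \<open>One round. The pairs in \<open>W \<times> W\<close> split into those whose symbol
  belongs to a row of \<open>W\<close>, those with overlapping rearrangements, and the rest, which
  supply new rows. The three terms on the right bound these classes.\<close>

lemma release_family_step:
  assumes fam: "release_family W D K"
  obtains W' D' where "release_family W' D' (3 * K)"
    "W \<subseteq> W'" "(card W)\<^sup>2 \<le> n * (card (W \<inter> F) + K\<^sup>2 + 3 * (card W' - card W))"
proof -
  have W: "W \<subseteq> {..<n}" "{..<n} - F \<subseteq> W" and Dx: "\<And>x. card {g \<in> W. x \<in> D g} \<le> K"
    and Dg: "\<And>g. g \<in> W \<Longrightarrow> releasable (D g) g" "\<And>g. g \<in> W \<Longrightarrow> D g \<subseteq> W"
      "\<And>g. g \<in> W \<Longrightarrow> card (D g) \<le> K"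
    using fam unfolding release_family_def by auto
  have finW: "finite W" using W finite_subset by blast
  define sym where "sym p = A (fst p) (\<sigma> (snd p))" for p
  define Q where "Q = {p \<in> W \<times> W. D (fst p) \<inter> D (snd p) = {} \<and> sym p \<in> row_symbol ` (F - W)}"
  have finQ: "finite Q" using finW unfolding Q_def by auto
  have cardW: "card W \<le> n" using W(1) card_mono[of "{..<n}" W] by simp
  \<comment> \<open>Maximality enters here: by \<open>symbol_used\<close>, a pair with disjoint
    rearrangements shows the symbol of some row of \<open>F\<close>, inside or outside
    \<open>W\<close>.\<close>
  have "W \<times> W \<subseteq> {p \<in> W \<times> W. sym p \<in> row_symbol ` (W \<inter> F)} \<union>
      {p \<in> W \<times> W. D (fst p) \<inter> D (snd p) \<noteq> {}} \<union> Q"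
  proof
    fix p assume p: "p \<in> W \<times> W"
    then have "sym p \<in> row_symbol ` F" if "D (fst p) \<inter> D (snd p) = {}"
      using symbol_used[OF Dg(1) Dg(1) that] unfolding sym_def by auto
    then show "p \<in> {p \<in> W \<times> W. sym p \<in> row_symbol ` (W \<inter> F)} \<union>
      {p \<in> W \<times> W. D (fst p) \<inter> D (snd p) \<noteq> {}} \<union> Q"
      using p unfolding Q_def by blast
  qed
  then have "card (W \<times> W) \<le> card ({p \<in> W \<times> W. sym p \<in> row_symbol ` (W \<inter> F)} \<union>
      {p \<in> W \<times> W. D (fst p) \<inter> D (snd p) \<noteq> {}} \<union> Q)"
    using finW finQ by (intro card_mono) auto
  also have "\<dots> \<le> card {p \<in> W \<times> W. sym p \<in> row_symbol ` (W \<inter> F)} +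
      card {p \<in> W \<times> W. D (fst p) \<inter> D (snd p) \<noteq> {}} + card Q"
    by (meson card_Un_le add_le_mono1 le_trans)
  also have "\<dots> \<le> card (W \<inter> F) * n + n * K\<^sup>2 + card Q"
  proof -
    have "card {p \<in> W \<times> W. sym p \<in> row_symbol ` (W \<inter> F)} \<le> card (row_symbol ` (W \<inter> F)) * n"
      using finW card_symbol_pairs[OF W(1)] unfolding sym_def by (intro card_le_fibres) auto
    also have "\<dots> \<le> card (W \<inter> F) * n"
      using finW by (intro mult_right_mono card_image_le) auto
    finally show ?thesis using card_conflicts[OF fam] by simp
  qed
  finally have count: "(card W)\<^sup>2 \<le> card (W \<inter> F) * n + n * K\<^sup>2 + card Q"
    by (simp add: card_cartesian_product power2_eq_square)

  have fst_fibre: "card {p \<in> Q. fst p = b} \<le> n" for b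
  proof -
    have "{p \<in> Q. fst p = b} \<subseteq> {b} \<times> W" unfolding Q_def by auto
    then have "card {p \<in> Q. fst p = b} \<le> card ({b} \<times> W)"
      using finW by (intro card_mono) auto
    then show ?thesis using cardW by (simp add: card_cartesian_product)
  qed
  have snd_fibre: "card {p \<in> Q. snd p = b} \<le> n" for b
  proof -
    have "{p \<in> Q. snd p = b} \<subseteq> W \<times> {b}" unfolding Q_def by auto
    then have "card {p \<in> Q. snd p = b} \<le> card (W \<times> {b})"
      using finW by (intro card_mono) auto
    then show ?thesis using cardW by (simp add: card_cartesian_product)
  qed
  have sym_fibre: "card {p \<in> Q. sym p = b} \<le> n" for b
  proof -
    have "card {p \<in> Q. sym p = b} \<le> card {p \<in> W \<times> W. sym p = b}"
      using finW unfolding Q_def by (intro card_mono) auto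
    also have "\<dots> \<le> n" using card_symbol_pairs[OF W(1)] unfolding sym_def .
    finally show ?thesis .
  qed
  \<comment> \<open>Distinct symbols make the new rows distinct. Distinct first and distinct second
    components let each old rearrangement be reused at most twice, which keeps the overlaps
    bounded.\<close>
  obtain E where E: "E \<subseteq> Q" "inj_on fst E" "inj_on snd E" "inj_on sym E"
    and cardQ: "card Q \<le> 3 * n * card E"
    by (rule exists_large_partial_transversal[OF finQ fst_fibre snd_fibre sym_fibre])

  \<comment> \<open>\<open>src p\<close> is the row of \<open>F\<close> whose entry has the symbol
    of the pair \<open>p\<close>; this is the row that \<open>p\<close> releases.\<close>
  define src where "src p = the_inv_into F row_symbol (sym p)" for p
  have src: "src p \<in> F - W" "row_symbol (src p) = sym p" if p: "p \<in> E" for p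
  proof -
    obtain s where s: "s \<in> F - W" "sym p = row_symbol s"
      using p E(1) unfolding Q_def by auto
    then have "src p = s"
      unfolding src_def using the_inv_into_f_f[OF F_inj] by auto
    then show "src p \<in> F - W" "row_symbol (src p) = sym p" using s by auto
  qed
  have src_inj: "inj_on src E"
    using E(4) src(2) by (metis (no_types, lifting) inj_on_def)
  define W' where "W' = W \<union> src ` E"
  define cell where "cell = the_inv_into E src"
  have cell: "cell (src p) = p" if "p \<in> E" for p
    unfolding cell_def using the_inv_into_f_f[OF src_inj that] .
  define D' where "D' g = (if g \<in> W then D g
    else insert g (D (fst (cell g)) \<union> D (snd (cell g))))" for g
  have D'_old: "D' g = D g" if "g \<in> W" for g using that unfolding D'_def by simp
  have D'_new: "D' (src p) = insert (src p) (D (fst p) \<union> D (snd p))" if "p \<in> E" for p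
    using that src(1)[OF that] cell unfolding D'_def by auto
  have EW: "fst p \<in> W" "snd p \<in> W" "D (fst p) \<inter> D (snd p) = {}" if "p \<in> E" for p
    using that E(1) unfolding Q_def by auto
  have finE: "finite E" using E(1) finQ finite_subset by blast

  \<comment> \<open>This absorbs the inserted row itself:
    \<open>2 * K + 1 \<le> 3 * K\<close>.\<close>
  have K: "1 \<le> K" if "p \<in> E" for p
  proof -
    have "fst p \<in> D (fst p)" "finite (D (fst p))"
      using Dg(1,2)[OF EW(1)[OF that]] finW finite_subset unfolding releasable_def by auto
    then have "card (D (fst p)) \<noteq> 0" by auto
    then show ?thesis using Dg(3)[OF EW(1)[OF that]] by linarith
  qed
  have new: "releasable (D' (src p)) (src p) \<and> D' (src p) \<subseteq> W' \<and> card (D' (src p)) \<le> 3 * K"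
    if p: "p \<in> E" for p
  proof (intro conjI)
    have sub: "D (fst p) \<union> D (snd p) \<subseteq> W" using Dg(2) EW[OF p] by auto
    show "releasable (D' (src p)) (src p)"
      unfolding D'_new[OF p]
      using src[OF p] sub by (intro releasable_step[OF Dg(1) Dg(1)]) (auto simp: EW[OF p] sym_def)
    show "D' (src p) \<subseteq> W'"
      unfolding D'_new[OF p] W'_def using sub p by auto
    have "card (D' (src p)) \<le> Suc (card (D (fst p) \<union> D (snd p)))"
      unfolding D'_new[OF p] by (rule card_insert_le_m1) auto
    also have "\<dots> \<le> Suc (card (D (fst p)) + card (D (snd p)))"
      using card_Un_le by simp
    also have "\<dots> \<le> 3 * K"
      using Dg(3)[OF EW(1)[OF p]] Dg(3)[OF EW(2)[OF p]] K[OF p] by linarith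
    finally show "card (D' (src p)) \<le> 3 * K" .
  qed
  \<comment> \<open>A row outside \<open>W\<close> can lie only in its own new set. A row of
    \<open>W\<close> lies in at most \<open>K\<close> old sets, each passed on to at most one new
    row as first and one as second component, hence the factor 3.\<close>
  have touched: "card {g \<in> W'. x \<in> D' g} \<le> 3 * K" for x
  proof (cases "x \<in> W")
    case False
    have "{g \<in> W'. x \<in> D' g} \<subseteq> (if x \<in> src ` E then {x} else {})"
    proof
      fix g assume g: "g \<in> {g \<in> W'. x \<in> D' g}"
      show "g \<in> (if x \<in> src ` E then {x} else {})"
      proof (cases "g \<in> W")
        case True
        then show ?thesis using g D'_old[OF True] Dg(2)[OF True] \<open>x \<notin> W\<close> by auto
      next
        case False
        then obtain p where p: "p \<in> E" "g = src p" using g unfolding W'_def by auto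
        then have "x = src p"
          using g D'_new[OF p(1)] Dg(2)[OF EW(1)[OF p(1)]] Dg(2)[OF EW(2)[OF p(1)]] \<open>x \<notin> W\<close> by auto
        then show ?thesis using p by auto
      qed
    qed
    then have "card {g \<in> W'. x \<in> D' g} \<le> card (if x \<in> src ` E then {x} else {})"
      by (intro card_mono) auto
    also have "\<dots> \<le> 3 * K" using K by force
    finally show ?thesis .
  next
    case True
    let ?G = "{g \<in> W. x \<in> D g}"
    have "{g \<in> W'. x \<in> D' g} \<subseteq> ?G \<union> src ` {p \<in> E. fst p \<in> ?G} \<union> src ` {p \<in> E. snd p \<in> ?G}"
    proof
      fix g assume g: "g \<in> {g \<in> W'. x \<in> D' g}"
      show "g \<in> ?G \<union> src ` {p \<in> E. fst p \<in> ?G} \<union> src ` {p \<in> E. snd p \<in> ?G}"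
      proof (cases "g \<in> W")
        case True
        then show ?thesis using g D'_old by auto
      next
        case False
        then obtain p where p: "p \<in> E" "g = src p" using g unfolding W'_def by auto
        then have "x \<in> D (fst p) \<union> D (snd p)"
          using g D'_new[OF p(1)] src(1)[OF p(1)] True by auto
        then show ?thesis using p EW[OF p(1)] by auto
      qed
    qed
    then have "card {g \<in> W'. x \<in> D' g}
        \<le> card (?G \<union> src ` {p \<in> E. fst p \<in> ?G} \<union> src ` {p \<in> E. snd p \<in> ?G})"
      using finW finE by (intro card_mono) auto
    also have "\<dots> \<le> card ?G + card (src ` {p \<in> E. fst p \<in> ?G}) + card (src ` {p \<in> E. snd p \<in> ?G})"
      by (meson card_Un_le add_le_mono1 le_trans)
    also have "\<dots> \<le> card ?G + card {p \<in> E. fst p \<in> ?G} + card {p \<in> E. snd p \<in> ?G}"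
      using finE by (intro add_mono card_image_le) auto
    also have "\<dots> \<le> card ?G + card ?G + card ?G"
    proof (intro add_mono order_refl)
      show "card {p \<in> E. fst p \<in> ?G} \<le> card ?G"
        using finW inj_on_subset[OF E(2)] by (intro card_inj_on_le[of fst]) auto
      show "card {p \<in> E. snd p \<in> ?G} \<le> card ?G"
        using finW inj_on_subset[OF E(3)] by (intro card_inj_on_le[of snd]) auto
    qed
    also have "\<dots> \<le> 3 * K" using Dx[of x] by linarith
    finally show ?thesis .
  qed
  have old: "releasable (D' g) g \<and> D' g \<subseteq> W' \<and> card (D' g) \<le> 3 * K" if "g \<in> W" for g
    using Dg[OF that] D'_old[OF that] unfolding W'_def by auto
  have "W' \<subseteq> {..<n}" using W(1) src(1) F_sub unfolding W'_def by auto
  moreover have "{..<n} - F \<subseteq> W'" using W(2) unfolding W'_def by blast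
  moreover have "\<forall>g\<in>W'. releasable (D' g) g \<and> D' g \<subseteq> W' \<and> card (D' g) \<le> 3 * K"
    using old new unfolding W'_def by blast
  ultimately have "release_family W' D' (3 * K)"
    using touched unfolding release_family_def by blast
  moreover have "card W' = card W + card E"
  proof -
    have "W \<inter> src ` E = {}" using src(1) by blast
    then show ?thesis
      unfolding W'_def using finW finE card_image[OF src_inj] by (simp add: card_Un_disjoint)
  qed
  moreover have "(card W)\<^sup>2 \<le> n * (card (W \<inter> F) + K\<^sup>2 + 3 * card E)"
    using count cardQ by (simp add: algebra_simps)
  ultimately show ?thesis using that[of W' D'] unfolding W'_def by simp
qed

section \<open>Linear growth and the resulting contradiction\<close>

text \<open>\<open>K\<close> triples in each round, so overlaps in the round after the
  \<open>i\<close>-th cost \<open>n * 9 ^ i\<close>. The assumption on \<open>n\<close> keeps this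
  within half of the available surplus \<open>\<epsilon> * n\<^sup>2\<close>.\<close>

lemma release_family_growth:
  fixes \<epsilon> :: real
  assumes "\<epsilon> > 0" and few: "real (card F) \<le> (3/4 - \<epsilon>) * real n"
    and "2 * 9 ^ i \<le> \<epsilon> * real n"
  shows "\<exists>W D. release_family W D (3 ^ i) \<and> real i * (\<epsilon> / 6 * real n) \<le> real (card W)"
  using assms(3)
proof (induction i)
  case 0
  then show ?case using release_family_holes by auto
next
  case (Suc i)
  have large: "2 * 9 ^ i \<le> \<epsilon> * real n"
    using Suc.prems by (simp add: field_simps) (smt (verit) zero_le_power)
  then obtain W D where W: "release_family W D (3 ^ i)" "real i * (\<epsilon> / 6 * real n) \<le> real (card W)"
    using Suc.IH by blast
  obtain W' D' where W': "release_family W' D' (3 * 3 ^ i)" "W \<subseteq> W'"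
    and step: "(card W)\<^sup>2 \<le> n * (card (W \<inter> F) + (3 ^ i)\<^sup>2 + 3 * (card W' - card W))"
    using release_family_step[OF W(1)] .
  have "finite W'" using W'(1) finite_subset unfolding release_family_def by blast
  then have le: "card W \<le> card W'" using W'(2) card_mono by blast
  have sub: "{..<n} - F \<subseteq> W" "W \<subseteq> {..<n}" using W(1) unfolding release_family_def by auto
  have split: "card W = card (W \<inter> F) + (n - card F)"
  proof -
    have "W = (W \<inter> F) \<union> ({..<n} - F)" using sub by auto
    then have "card W = card (W \<inter> F) + card ({..<n} - F)"
      using sub(2) finite_subset[OF sub(2)] by (metis card_Un_disjoint Diff_disjoint finite_Diff
          finite_Int finite_lessThan inf.assoc inf_bot_right)
    then show ?thesis
      using F_sub finite_subset[OF F_sub] by (simp add: card_Diff_subset)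
  qed
  have "card F \<le> n" using F_sub card_mono[of "{..<n}" F] by simp
  define w where "w = real (card W)"
  define e where "e = real (card W') - real (card W)"
  have "0 < \<epsilon> * real n" by (rule order.strict_trans2[OF _ large]) simp
  then have n: "real n > 0" using \<open>\<epsilon> > 0\<close> by (simp add: zero_less_mult_iff)
  have eq: "real (card (W \<inter> F)) = w - real n + real (card F)"
    using split \<open>card F \<le> n\<close> unfolding w_def by linarith
  have "real ((card W)\<^sup>2) \<le> real (n * (card (W \<inter> F) + (3 ^ i)\<^sup>2 + 3 * (card W' - card W)))"
    using step of_nat_mono by blast
  then have "w\<^sup>2 \<le> real n * ((w - real n + real (card F)) + (3 ^ i)\<^sup>2 + 3 * e)"
    using le eq unfolding w_def e_def by (simp add: of_nat_diff)
  also have "(3 ^ i)\<^sup>2 = (9::real) ^ i"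
    by (simp add: power2_eq_square flip: power_mult_distrib)
  also have "real n * ((w - real n + real (card F)) + 9 ^ i + 3 * e)
      \<le> real n * ((w - real n + (3/4 - \<epsilon>) * real n) + \<epsilon> * real n / 2 + 3 * e)"
    using n few large by (intro mult_left_mono) auto
  finally have "w\<^sup>2 \<le> real n * (w - real n / 4 - \<epsilon> * real n / 2 + 3 * e)"
    by (simp add: algebra_simps)
  \<comment> \<open>Completing the square gives
    \<open>w\<^sup>2 \<ge> w * n - n\<^sup>2 / 4\<close>. This is the source of the constant 3/4:
    the terms in \<open>w * n\<close> and \<open>n\<^sup>2 / 4\<close> cancel, and the remaining
    half of the surplus bounds \<open>e\<close> from below.\<close>
  moreover have "0 \<le> (w - real n / 2)\<^sup>2" by simp
  ultimately have "real n * (\<epsilon> * real n / 2) \<le> real n * (3 * e)"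
    by (simp add: power2_eq_square algebra_simps)
  then have "\<epsilon> / 6 * real n \<le> e" using n by simp
  then have "real (Suc i) * (\<epsilon> / 6 * real n) \<le> real (card W')"
    using W(2) unfolding e_def by (simp add: algebra_simps)
  then show ?case using W'(1) by auto
qed

text \<open>If \<open>F\<close> were too small, \<open>L\<close> rounds would release at least
  \<open>L * \<epsilon> * n / 6 > n\<close> rows.\<close>

lemma card_gt:
  fixes \<epsilon> :: real
  assumes "\<epsilon> > 0" "6 < real L * \<epsilon>" "2 * 9 ^ L \<le> \<epsilon> * real n"
  shows "(3/4 - \<epsilon>) * real n < real (card F)"
proof (rule ccontr)
  assume "\<not> ?thesis"
  then obtain W D where W: "release_family W D (3 ^ L)" "real L * (\<epsilon> / 6 * real n) \<le> real (card W)"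
    using release_family_growth[OF assms(1) _ assms(3)] by auto
  have "0 < \<epsilon> * real n" by (rule order.strict_trans2[OF _ assms(3)]) simp
  then have "0 < n" using assms(1) by (simp add: zero_less_mult_iff)
  then have "6 * real n < real L * \<epsilon> * real n"
    using assms(2) by (intro mult_strict_right_mono) auto
  then have "real n < real (card W)" using W(2) by simp
  moreover have "card W \<le> n"
    using W(1) card_mono[of "{..<n}" W] unfolding release_family_def by simp
  ultimately show False by simp
qed

end

section \<open>Extension to a permutation and choice of constants\<close>

lemma exists_maximum_transversal:
  assumes "equi_square n S A"
  obtains \<sigma> F T where "maximum_transversal n S A \<sigma> F" "is_transversal n A T" "card T = card F"
proof -
  have "is_transversal n A {}" unfolding is_transversal_def by simp
  moreover have "\<forall>T. is_transversal n A T \<longrightarrow> card T < Suc (n * n)"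
  proof (intro allI impI)
    fix T assume "is_transversal n A T"
    then have "card T \<le> card ({..<n} \<times> {..<n})"
      unfolding is_transversal_def by (intro card_mono) auto
    then show "card T < Suc (n * n)" by simp
  qed
  ultimately obtain T where T: "is_transversal n A T"
    and max: "\<And>T'. is_transversal n A T' \<Longrightarrow> card T' \<le> card T"
    using ex_has_greatest_nat[of "is_transversal n A" "{}" card] by blast
  have inj: "inj_on fst T" "inj_on snd T" "inj_on (\<lambda>p. A (fst p) (snd p)) T"
    and sub: "T \<subseteq> {..<n} \<times> {..<n}"
    using T unfolding is_transversal_iff_inj by auto
  define F where "F = fst ` T"
  define \<tau> where "\<tau> r = snd (the_inv_into T fst r)" for r
  have \<tau>: "\<tau> (fst p) = snd p" if "p \<in> T" for p
    unfolding \<tau>_def using the_inv_into_f_f[OF inj(1) that] by simp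
  have F: "F \<subseteq> {..<n}" "snd ` T \<subseteq> {..<n}" using sub unfolding F_def by auto
  have bijT: "bij_betw \<tau> F (snd ` T)"
    unfolding bij_betw_def
  proof
    show "inj_on \<tau> F"
      using inj(2) \<tau> unfolding F_def inj_on_def by (metis (no_types, lifting) imageE)
    show "\<tau> ` F = snd ` T"
      unfolding F_def image_image using \<tau> by (rule image_cong[OF refl])
  qed
  \<comment> \<open>The transversal misses equally many rows and columns, so any bijection \<pi>
    between these completes \<tau> to a permutation.\<close>
  have "card ({..<n} - F) = card ({..<n} - snd ` T)"
    using F finite_subset[OF F(1)] finite_subset[OF F(2)] bij_betw_same_card[OF bijT]
    by (simp add: card_Diff_subset)
  then obtain \<pi> where \<pi>: "bij_betw \<pi> ({..<n} - F) ({..<n} - snd ` T)"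
    using finite_same_card_bij[of "{..<n} - F" "{..<n} - snd ` T"] by auto
  define \<sigma> where "\<sigma> r = (if r \<in> F then \<tau> r else \<pi> r)" for r
  have "bij_betw \<sigma> (F \<union> ({..<n} - F)) (snd ` T \<union> ({..<n} - snd ` T))"
    unfolding \<sigma>_def using bij_betw_disjoint_Un[OF bijT \<pi>] by auto
  then have "bij_betw \<sigma> {..<n} {..<n}"
    using F by (simp add: Un_absorb1)
  moreover have "inj_on (\<lambda>r. A r (\<sigma> r)) F"
  proof (rule inj_onI)
    fix x y assume xy: "x \<in> F" "y \<in> F" "A x (\<sigma> x) = A y (\<sigma> y)"
    then obtain p q where "p \<in> T" "x = fst p" "q \<in> T" "y = fst q" unfolding F_def by auto
    then show "x = y" using xy inj(3) \<tau> unfolding \<sigma>_def by (auto dest: inj_onD)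
  qed
  moreover have "card T = card F" unfolding F_def using card_image[OF inj(1)] by simp
  moreover from this have "maximum_transversal n S A \<sigma> F"
    using assms F(1) max calculation by unfold_locales auto
  ultimately show ?thesis
    using that T by blast
qed

theorem theorem1p3:
  shows "\<forall>\<epsilon>::real. \<epsilon> > 0 \<longrightarrow>
    (\<exists>n\<^sub>0::nat. \<forall>n\<ge>n\<^sub>0. \<forall>(S :: 'a set) A. equi_square n S A \<longrightarrow>
      (\<exists>T. is_transversal n A T \<and> real (card T) \<ge> (3/4 - \<epsilon>) * real n))"
proof (intro allI impI)
  fix \<epsilon> :: real assume \<epsilon>: "\<epsilon> > 0"
  \<comment> \<open>\<open>L\<close> is the number of rounds; \<open>n\<^sub>0\<close> is then
    chosen so large that overlaps stay negligible through all of them.\<close>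
  obtain L :: nat where L: "6 < real L * \<epsilon>"
    using reals_Archimedean3[OF \<epsilon>] by blast
  obtain n\<^sub>0 :: nat where n\<^sub>0: "2 * 9 ^ L < real n\<^sub>0 * \<epsilon>"
    using reals_Archimedean3[OF \<epsilon>] by blast
  have "\<exists>T. is_transversal n A T \<and> real (card T) \<ge> (3/4 - \<epsilon>) * real n"
    if n: "n \<ge> n\<^sub>0" and equi: "equi_square n S A" for n and S :: "'a set" and A
  proof -
    obtain \<sigma> F T where T: "maximum_transversal n S A \<sigma> F" "is_transversal n A T" "card T = card F"
      using exists_maximum_transversal[OF equi] .
    have "real n\<^sub>0 * \<epsilon> \<le> real n * \<epsilon>" using n \<epsilon> by simp
    then have "2 * 9 ^ L \<le> \<epsilon> * real n" using n\<^sub>0 by (simp add: mult.commute)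
    from maximum_transversal.card_gt[OF T(1) \<epsilon> L this] show ?thesis
      using T(2,3) by auto
  qed
  then show "\<exists>n\<^sub>0::nat. \<forall>n\<ge>n\<^sub>0. \<forall>(S :: 'a set) A. equi_square n S A \<longrightarrow>
      (\<exists>T. is_transversal n A T \<and> real (card T) \<ge> (3/4 - \<epsilon>) * real n)" by blast
qed

end
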